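(* Let $n \ge 2$ be an integer. There exists a set $\mathcal{G}$ of (non-oriented, loopless) graphs on the vertex set $[n]$, containing at least half of all such graphs, such that no two distinct graphs $G_1, G_2 \in \mathcal{G}$ have edge sets $E(G_1), E(G_2)$ with $E(G_1)\,\Delta\, E(G_2) = \{\{x,y\} : x,y \in I,\ x \ne y\}$ for some interval $I \subset [n]$ (that is, the symmetric difference of the edge sets is never the edge set of a clique whose vertex set is an interval).
   Context: $[n]=\{1,\dots,n\}$; for integers $a \le b$, $[a,b]=\{a,a+1,\dots,b\}$ is called an interval. $\Delta$ denotes symmetric difference. *)

theory Defs
  imports Main
begin

type_synonym 'a ugraph = "'a set \<times> 'a set set"

abbreviation verts :: "'a ugraph \<Rightarrow> 'a set" where
  "verts G \<equiv> fst G"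

abbreviation edges :: "'a ugraph \<Rightarrow> 'a set set" where
  "edges G \<equiv> snd G"

definition clique_edges :: "'a set \<Rightarrow> 'a set set" where
  "clique_edges V = {{x, y} | x y. x \<in> V \<and> y \<in> V \<and> x \<noteq> y}"

definition graphs_on :: "'a set \<Rightarrow> 'a ugraph set" where
  "graphs_on V = {G. verts G = V \<and> edges G \<subseteq> clique_edges V}"

definition is_interval_set :: "nat set \<Rightarrow> bool" where
  "is_interval_set I \<longleftrightarrow> (\<exists>a b. a \<le> b \<and> I = {a..b})"

end

theory Submission
  imports Defs
begin

text \<open>
  Let \<open>F\<close> be the set of pairs of integers at distance 1 or 2. A clique on an interval with
  \<open>m \<ge> 2\<close> vertices contains \<open>(m - 1) + (m - 2) = 2m - 3\<close> members of \<open>F\<close>, an odd number.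
  Hence the graphs with an even number of edges in \<open>F\<close> never differ by such a clique, and
  toggling the edge \<open>{1, 2}\<close> injects the remaining graphs into them.
\<close>

text \<open>This is the set F above, taken over all naturals; intersecting with an edge set cuts it
  down to the pairs at hand.\<close>

definition short_edges :: "nat set set" where
  "short_edges = range (\<lambda>x. {x, x + 1}) \<union> range (\<lambda>x. {x, x + 2})"

lemma finite_clique_edges: "finite V \<Longrightarrow> finite (clique_edges V)"
  by (rule finite_subset[of _ "Pow V"]) (auto simp: clique_edges_def)

lemma clique_edges_singleton: "clique_edges {a} = {}"
  by (auto simp: clique_edges_def)

lemma finite_graphs_on: "finite V \<Longrightarrow> finite (graphs_on V)"
  by (rule finite_subset[of _ "{V} \<times> Pow (clique_edges V)"])
    (auto simp: graphs_on_def finite_clique_edges)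

text \<open>Each short pair is indexed by its smaller element \<open>x\<close>. The pair at distance
  2 fits when \<open>x + 2 \<le> b\<close>, that is \<open>x < b - 1\<close>, also under truncated
  subtraction.\<close>

lemma clique_edges_interval_Int_short_edges:
  "clique_edges {a..b} \<inter> short_edges =
    (\<lambda>x. {x, x + 1}) ` {a..<b} \<union> (\<lambda>x. {x, x + 2}) ` {a..<b - 1}"
proof (intro equalityI subsetI)
  fix e assume "e \<in> clique_edges {a..b} \<inter> short_edges"
  then obtain x y z where "e = {x, y}" "x \<in> {a..b}" "y \<in> {a..b}"
    and z: "e = {z, z + 1} \<or> e = {z, z + 2}"
    by (auto simp: clique_edges_def short_edges_def)
  \<comment> \<open>Containment suffices to bound \<open>z\<close>, with no need to match
    \<open>x\<close> and \<open>y\<close> against the endpoints \<open>z\<close> and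
    \<open>z + 1\<close> or \<open>z + 2\<close>.\<close>
  then have "e \<subseteq> {a..b}" by auto
  with z show "e \<in> (\<lambda>x. {x, x + 1}) ` {a..<b} \<union> (\<lambda>x. {x, x + 2}) ` {a..<b - 1}"
    by auto
next
  have "{x, x + 1} \<in> clique_edges {a..b}" if "x \<in> {a..<b}" for x
    using that by (fastforce simp: clique_edges_def)
  moreover have "{x, x + 2} \<in> clique_edges {a..b}" if "x \<in> {a..<b - 1}" for x
    using that by (fastforce simp: clique_edges_def)
  ultimately show "e \<in> clique_edges {a..b} \<inter> short_edges"
    if "e \<in> (\<lambda>x. {x, x + 1}) ` {a..<b} \<union> (\<lambda>x. {x, x + 2}) ` {a..<b - 1}" for e
    using that by (auto simp: short_edges_def)
qed

lemma odd_card_interval_clique_short_edges: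
  assumes "a < b"
  shows "odd (card (clique_edges {a..b} \<inter> short_edges))"
proof -
  have "inj_on (\<lambda>x. {x, x + 1}) {a..<b}" "inj_on (\<lambda>x. {x, x + 2}) {a..<b - 1}"
    by (auto simp: inj_on_def doubleton_eq_iff)
  moreover have "(\<lambda>x. {x, x + 1}) ` {a..<b} \<inter> (\<lambda>x. {x, x + 2}) ` {a..<b - 1} = {}"
    by (auto simp: doubleton_eq_iff)
  ultimately have "card (clique_edges {a..b} \<inter> short_edges) = (b - a) + (b - 1 - a)"
    unfolding clique_edges_interval_Int_short_edges
    by (simp only: card_Un_disjoint finite_imageI finite_atLeastLessThan card_image
        card_atLeastLessThan)
  \<comment> \<open>Here \<open>a < b\<close> matters: for \<open>a = b\<close> both truncated
    differences are 0 and the sum is even.\<close>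
  also have "\<dots> = 2 * (b - 1 - a) + 1"
    using assms by simp
  finally show ?thesis by simp
qed

text \<open>The common part \<open>A \<inter> B\<close> is counted once in \<open>card A\<close> and
  once in \<open>card B\<close>, so it cancels modulo 2.\<close>

lemma even_card_sym_diff_iff:
  assumes "finite A" "finite B"
  shows "even (card (sym_diff A B)) \<longleftrightarrow> (even (card A) \<longleftrightarrow> even (card B))"
proof -
  have "card (sym_diff A B) = card (A - B) + card (B - A)"
    using assms by (intro card_Un_disjoint) auto
  moreover have "card A = card (A - B) + card (A \<inter> B)"
    using assms card_Int_Diff[of A B] by simp
  moreover have "card B = card (B - A) + card (A \<inter> B)"
    using assms card_Int_Diff[of B A] by (simp add: Int_commute)
  ultimately show ?thesis by auto
qed

text \<open>Intersecting with \<open>F\<close> distributes over symmetric difference.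
  \<open>F\<close> itself may be infinite, as \<open>short_edges\<close> is.\<close>

lemma even_card_sym_diff_Int_iff:
  assumes "finite A" "finite B"
  shows "even (card (sym_diff A B \<inter> F)) \<longleftrightarrow>
    (even (card (A \<inter> F)) \<longleftrightarrow> even (card (B \<inter> F)))"
proof -
  have "sym_diff A B \<inter> F = sym_diff (A \<inter> F) (B \<inter> F)" by auto
  then show ?thesis
    using even_card_sym_diff_iff[of "A \<inter> F" "B \<inter> F"] assms by simp
qed

lemma half_graphs_even:
  assumes "finite V" "e \<in> clique_edges V" "e \<in> F"
  shows "card (graphs_on V) \<le> 2 * card {G \<in> graphs_on V. even (card (edges G \<inter> F))}"
proof -
  let ?even = "{G \<in> graphs_on V. even (card (edges G \<inter> F))}"
  let ?odd = "{G \<in> graphs_on V. odd (card (edges G \<inter> F))}"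
  let ?toggle = "\<lambda>G. (verts G, sym_diff (edges G) {e})"
  have "inj_on ?toggle ?odd"
    by (rule inj_onI) (auto simp: prod_eq_iff)
  moreover have "?toggle ` ?odd \<subseteq> ?even"
  proof (rule image_subsetI)
    fix G assume G: "G \<in> ?odd"
    then have "finite (edges G)"
      using finite_clique_edges[OF assms(1)] by (auto simp: graphs_on_def intro: finite_subset)
    \<comment> \<open>Since \<open>e \<in> F\<close>, the set \<open>{e} \<inter> F\<close> has one
      element, so toggling \<open>e\<close> flips the parity.\<close>
    from even_card_sym_diff_Int_iff[OF this, of "{e}" F]
    have "even (card (sym_diff (edges G) {e} \<inter> F))"
      using G assms(3) by simp
    moreover have "?toggle G \<in> graphs_on V"
      using G assms(2) by (auto simp: graphs_on_def)
    ultimately show "?toggle G \<in> ?even" by simp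
  qed
  ultimately have "card ?odd \<le> card ?even"
    using finite_graphs_on[OF assms(1)] by (intro card_inj_on_le) auto
  moreover have "graphs_on V = ?even \<union> ?odd" by auto
  then have "card (graphs_on V) \<le> card ?even + card ?odd"
    using card_Un_le[of ?even ?odd] by simp
  ultimately show ?thesis by simp
qed

theorem theorem2p2:
  fixes n :: nat
  assumes "n \<ge> 2"
  shows "\<exists>\<G> \<subseteq> graphs_on {1..n}.
    2 * card \<G> \<ge> card (graphs_on {1..n}) \<and>
    (\<forall>G1 \<in> \<G>. \<forall>G2 \<in> \<G>. G1 \<noteq> G2 \<longrightarrow>
      \<not> (\<exists>I. is_interval_set I \<and> I \<subseteq> {1..n} \<and>
            sym_diff (edges G1) (edges G2) = clique_edges I))"
proof -
  let ?\<G> = "{G \<in> graphs_on {1..n}. even (card (edges G \<inter> short_edges))}"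
  \<comment> \<open>The assumption \<open>n \<ge> 2\<close> provides a short edge to toggle.\<close>
  have "{1, 2} \<in> clique_edges {1..n}"
    using assms by (fastforce simp: clique_edges_def)
  moreover have "{1, 2} \<in> short_edges"
    unfolding short_edges_def by (intro UnI1 image_eqI[of _ _ 1]) auto
  ultimately have "card (graphs_on {1..n}) \<le> 2 * card ?\<G>"
    by (intro half_graphs_even[of _ "{1, 2}"]) auto
  moreover have False
    if G: "G1 \<in> ?\<G>" "G2 \<in> ?\<G>" "G1 \<noteq> G2" and I: "is_interval_set I"
      and eq: "sym_diff (edges G1) (edges G2) = clique_edges I" for G1 G2 I
  proof -
    obtain a b where ab: "a \<le> b" "I = {a..b}"
      using I by (auto simp: is_interval_set_def)
    \<comment> \<open>Both graphs have vertex set \<open>{1..n}\<close>, so they can differ only in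
      their edges. This rules out one-point intervals, whose clique is empty and would meet
      \<open>short_edges\<close> in an even number of pairs.\<close>
    have "edges G1 \<noteq> edges G2"
      using G by (auto simp: graphs_on_def prod_eq_iff)
    then have "clique_edges I \<noteq> {}"
      unfolding eq[symmetric] by auto
    with ab have "a < b"
      by (cases "a = b") (auto simp: clique_edges_singleton)
    have "finite (edges G1)" "finite (edges G2)"
      using G finite_clique_edges[of "{1..n}"] by (auto simp: graphs_on_def intro: finite_subset)
    \<comment> \<open>Two even counts force an even count on the difference, against the odd count
      for an interval clique.\<close>
    from even_card_sym_diff_Int_iff[OF this, of short_edges]
    have "even (card (clique_edges I \<inter> short_edges))"
      using G unfolding eq by simp
    with odd_card_interval_clique_short_edges[OF \<open>a < b\<close>] ab(2) show False by simp
  qed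
  ultimately show ?thesis by (intro exI[of _ ?\<G>]) blast
qed

end
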